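(* Let $k\geq 1$ be an integer. If $X$ is a connected $k$-regular balanced graph, then the number of vertices of $X$ is divisible by $2k$.
   Context: Graphs are finite, simple and undirected. A graph is balanced if it is bipartite and has no induced circuit (cycle) of length congruent to $2\pmod 4$. *)

theory Defs
  imports "Graph_Theory.Graph_Theory"
begin

text \<open>
  A finite simple undirected graph is the locale \<^locale>\<open>graph\<close>: a finite, loop-free, symmetric
  digraph without parallel arcs, in which an edge is a pair of opposite arcs. Hence the degree of
  a vertex is its out-degree.
\<close>

definition k_regular :: "nat \<Rightarrow> ('a, 'b) pre_digraph \<Rightarrow> bool" where
  "k_regular k G \<longleftrightarrow> (\<forall>v \<in> verts G. out_degree G v = k)"

definition bipartite :: "('a, 'b) pre_digraph \<Rightarrow> bool" where
  "bipartite G \<longleftrightarrow> (\<exists>A B. A \<union> B = verts G \<and> A \<inter> B = {} \<and>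
     (\<forall>e \<in> arcs G. (tail G e \<in> A \<and> head G e \<in> B) \<or> (tail G e \<in> B \<and> head G e \<in> A)))"

text \<open>
  The length bound is needed because \<^const>\<open>pre_digraph.cycle\<close> also accepts an arc followed by its
  opposite, which is not a circuit of an undirected graph.
\<close>

definition circuit :: "('a, 'b) pre_digraph \<Rightarrow> 'b awalk \<Rightarrow> bool" where
  "circuit G p \<longleftrightarrow> pre_digraph.cycle G p \<and> 3 \<le> length p"

text \<open>
  The image of \<open>tail G\<close> on \<open>set p\<close> is the vertex set of the closed walk \<open>p\<close>. The converse is there
  because \<open>p\<close> traverses only one of the two arcs of each of its edges.
\<close>

definition induced_circuit :: "('a, 'b) pre_digraph \<Rightarrow> 'b awalk \<Rightarrow> bool" where
  "induced_circuit G p \<longleftrightarrow> circuit G p \<and>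
     arcs_ends (G \<restriction> (tail G ` set p)) = arc_to_ends G ` set p \<union> (arc_to_ends G ` set p)\<inverse>"

definition balanced :: "('a, 'b) pre_digraph \<Rightarrow> bool" where
  "balanced G \<longleftrightarrow> bipartite G \<and> (\<forall>p. induced_circuit G p \<longrightarrow> length p mod 4 \<noteq> 2)"

end

theory Submission
  imports Defs
begin

text \<open>
  Let \<open>A\<close> and \<open>B\<close> be the two sides of \<open>G\<close>. The neighbourhoods of the vertices in \<open>B\<close> are the
  edges of a hypergraph on \<open>A\<close>, all of size \<open>k\<close>, and balancedness of \<open>G\<close> says that this hypergraph is
  balanced in the sense of Berge: an odd cycle of the hypergraph whose edges contain no further
  vertex of the cycle would be an induced circuit of \<open>G\<close> of length twice an odd number
  (\<open>induced_circuit_if_odd_hole\<close>).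

  Berge proved that a balanced hypergraph has a \<open>k\<close>-colouring of its vertices in which every edge of
  size \<open>k\<close> contains each colour exactly once (\<open>ex_rainbow_colouring\<close>). This gives the divisibility by
  counting: if \<open>C\<close> is a colour class, then every vertex in \<open>B\<close> has exactly one neighbour in \<open>C\<close> and
  every vertex in \<open>C\<close> has \<open>k\<close> neighbours in \<open>B\<close>, so \<open>card B = k * card C\<close>. Hence the \<open>k\<close> colour
  classes have a common size \<open>m\<close>, both sides of \<open>G\<close> have \<open>k * m\<close> vertices, and \<open>G\<close> has \<open>2 * k * m\<close>.

  The colouring is obtained from the case of two colours (\<open>ex_bicolouring\<close>): in a \<open>k\<close>-colouring that
  maximises the total number of colours seen by the edges, an edge with a repeated and a missing
  colour would allow an improvement by recolouring these two classes.
\<close>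

section \<open>Colourings of balanced hypergraphs\<close>

text \<open>
  The submatrices forbidden in a balanced matrix: incidence matrices of odd cycles of length at least
  three. The edges need not be listed separately, since they have distinct traces on the cycle.
\<close>
definition odd_hole :: "'a set set \<Rightarrow> 'a list \<Rightarrow> bool" where
  "odd_hole H c \<longleftrightarrow> distinct c \<and> odd (length c) \<and> 3 \<le> length c \<and>
     (\<forall>i<length c. \<exists>e\<in>H. e \<inter> set c = {c ! i, c ! (Suc i mod length c)})"

text \<open>
  Induction on \<open>S\<close>, by extending a colouring of \<open>S - {v}\<close> to \<open>v\<close>. Only the edges whose trace on \<open>S\<close>
  is a pair \<open>{v, u}\<close> constrain the colour of \<open>v\<close>, so it suffices that all such \<open>u\<close> have the same
  colour. Two-element traces form a graph on \<open>S\<close>, and the first vertex \<open>v\<close> of a longest path in this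
  graph has all of its neighbours on the path. Along the rest of the path the colours alternate, and
  a neighbour at even distance along the path would close an odd hole.
\<close>
lemma ex_bicolouring:
  assumes "finite S" and "\<And>c. set c \<subseteq> S \<Longrightarrow> \<not> odd_hole H c"
  shows "\<exists>f :: 'a \<Rightarrow> bool. \<forall>e\<in>H. \<forall>x\<in>e \<inter> S. \<forall>y\<in>e \<inter> S. x \<noteq> y \<longrightarrow>
           (\<exists>z\<in>e \<inter> S. f z) \<and> (\<exists>z\<in>e \<inter> S. \<not> f z)"
  using assms
proof (induction "card S" arbitrary: S)
  case 0
  then show ?case by simp
next
  case (Suc n)
  define adj where "adj u v \<longleftrightarrow> u \<noteq> v \<and> (\<exists>e\<in>H. e \<inter> S = {u, v})" for u v
  define path where "path p \<longleftrightarrow> p \<noteq> [] \<and> distinct p \<and> set p \<subseteq> S \<and>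
      (\<forall>i. Suc i < length p \<longrightarrow> adj (p ! i) (p ! Suc i))" for p
  obtain s where s: "s \<in> S" using Suc.hyps(2) by fastforce
  have "path [s]" using s by (simp add: path_def)
  moreover have "length p < Suc (card S)" if "path p" for p
    using that Suc.prems(1) unfolding path_def
    by (metis card_mono distinct_card less_Suc_eq_le)
  ultimately obtain p where p: "path p" and longest: "\<And>q. path q \<Longrightarrow> length q \<le> length p"
    using ex_has_greatest_nat[of path "[s]" length "Suc (card S)"] by (metis less_imp_le)
  define v where "v = p ! 0"
  have pD: "p \<noteq> []" "distinct p" "set p \<subseteq> S"
    and pE: "\<And>i. Suc i < length p \<Longrightarrow> adj (p ! i) (p ! Suc i)"
    using p by (auto simp: path_def)
  have v: "v \<in> S" using pD by (auto simp: v_def)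
  have "n = card (S - {v})" using Suc.hyps(2) v Suc.prems(1) by simp
  then obtain f :: "'a \<Rightarrow> bool" where f: "\<And>e x y. e \<in> H \<Longrightarrow> x \<in> e \<inter> (S - {v}) \<Longrightarrow> y \<in> e \<inter> (S - {v}) \<Longrightarrow>
      x \<noteq> y \<Longrightarrow> (\<exists>z\<in>e \<inter> (S - {v}). f z) \<and> (\<exists>z\<in>e \<inter> (S - {v}). \<not> f z)"
  proof -
    have "\<not> odd_hole H c" if "set c \<subseteq> S - {v}" for c using that Suc.prems(2) by blast
    then show ?thesis
      using Suc.hyps(1)[of "S - {v}"] \<open>n = card (S - {v})\<close> Suc.prems(1) that by (metis finite_Diff)
  qed
  have proper: "f x \<noteq> f y" if "adj x y" "x \<noteq> v" "y \<noteq> v" for x y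
  proof -
    obtain e where e: "e \<in> H" "e \<inter> S = {x, y}" "x \<noteq> y" using \<open>adj x y\<close> by (auto simp: adj_def)
    then have "e \<inter> (S - {v}) = {x, y}" using that by auto
    then show ?thesis using f[of e x y] e by auto
  qed
  have alternate: "f (p ! i) = (f (p ! 1) = odd i)" if "1 \<le> i" "i < length p" for i
    using that
  proof (induction i rule: dec_induct)
    case base
    then show ?case by simp
  next
    case (step i)
    have "p ! i \<noteq> v" "p ! Suc i \<noteq> v"
      using step pD(1,2) by (auto simp: v_def nth_eq_iff_index_eq)
    then show ?case using proper[OF pE[OF step.prems]] step by auto
  qed
  have nbr: "f u = f (p ! 1)" if vu: "adj v u" for u
  proof -
    have uS: "u \<in> S" "u \<noteq> v" "adj u v" using vu by (auto simp: adj_def insert_commute)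
    have "u \<in> set p"
    proof (rule ccontr)
      assume "u \<notin> set p"
      then have "path (u # p)"
        using uS pD pE by (auto simp: path_def v_def nth_Cons split: nat.split)
      then show False using longest[of "u # p"] by simp
    qed
    then obtain i where i: "i < length p" "u = p ! i" by (auto simp: in_set_conv_nth)
    then have i1: "1 \<le> i" using uS by (cases i) (auto simp: v_def)
    have "odd i"
    proof (rule ccontr)
      assume ev: "\<not> odd i"
      \<comment> \<open>The part of the path from \<open>v\<close> to \<open>u\<close>, closed up by the edge with trace \<open>{v, u}\<close>.\<close>
      define c where "c = take (Suc i) p"
      have lc: "length c = Suc i" using i by (simp add: c_def)
      have cS: "set c \<subseteq> S" using pD by (auto simp: c_def dest: in_set_takeD)
      have nc: "c ! j = p ! j" if "j \<le> i" for j using that by (simp add: c_def)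
      have "\<exists>e\<in>H. e \<inter> set c = {c ! j, c ! (Suc j mod length c)}" if "j < length c" for j
      proof -
        have "adj (c ! j) (c ! (Suc j mod length c))"
        proof (cases "j = i")
          case True
          then show ?thesis using uS i lc by (simp add: nc v_def)
        next
          case False
          then show ?thesis using that lc pE[of j] i by (simp add: nc)
        qed
        then obtain e where e: "e \<in> H" "e \<inter> S = {c ! j, c ! (Suc j mod length c)}"
          by (auto simp: adj_def)
        have "c ! j \<in> set c" "c ! (Suc j mod length c) \<in> set c"
          using that by (auto intro!: nth_mem mod_less_divisor)
        then have "e \<inter> set c = {c ! j, c ! (Suc j mod length c)}" using e cS by blast
        then show ?thesis using e by blast
      qed
      moreover have "3 \<le> length c" using lc i1 ev by (cases "i = 1") auto
      ultimately have "odd_hole H c"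
        using pD(2) ev lc by (simp add: odd_hole_def c_def)
      then show False using Suc.prems(2) cS by blast
    qed
    then show ?thesis using alternate[OF i1 i(1)] i by simp
  qed
  define g where "g = f(v := \<not> f (p ! 1))"
  have "(\<exists>z\<in>e \<inter> S. g z) \<and> (\<exists>z\<in>e \<inter> S. \<not> g z)"
    if e: "e \<in> H" "x \<in> e \<inter> S" "y \<in> e \<inter> S" "x \<noteq> y" for e x y
  proof (cases "\<exists>x'\<in>e \<inter> (S - {v}). \<exists>y'\<in>e \<inter> (S - {v}). x' \<noteq> y'")
    case True
    then have "(\<exists>z\<in>e \<inter> (S - {v}). f z) \<and> (\<exists>z\<in>e \<inter> (S - {v}). \<not> f z)" using f e(1) by meson
    then show ?thesis by (auto simp: g_def)
  next
    case False
    then obtain u where u: "e \<inter> S = {v, u}" "u \<noteq> v" using e by blast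
    then have "adj v u" using e(1) by (auto simp: adj_def)
    then have "g u \<noteq> g v" using nbr u by (auto simp: g_def)
    then show ?thesis using u by auto
  qed
  then show ?case by blast
qed

text \<open>
  If a colouring is not injective on some edge, that edge repeats a colour \<open>P\<close> and misses a colour
  \<open>q\<close>. Redistributing \<open>P\<close> and \<open>q\<close> by a bicolouring of the union of the two classes gives both colours
  to each edge that meets this union at least twice, and leaves the number of colours unchanged on the
  other edges. So the total number of colours over the edges increases, which is impossible for a
  colouring that maximises it.
\<close>
lemma ex_rainbow_colouring:
  assumes "finite V" "finite H" "1 \<le> k"
    and edges: "\<And>e. e \<in> H \<Longrightarrow> e \<subseteq> V \<and> card e = k"
    and no_hole: "\<And>c. set c \<subseteq> V \<Longrightarrow> \<not> odd_hole H c"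
  shows "\<exists>c. c ` V \<subseteq> {..<k} \<and> (\<forall>e\<in>H. bij_betw c e {..<k})"
proof -
  define score where "score c = (\<Sum>e\<in>H. card (c ` e))" for c :: "'a \<Rightarrow> nat"
  have fin: "finite e" if "e \<in> H" for e using that edges assms(1) finite_subset by blast
  have "score c < Suc (card H * k)" for c
  proof -
    have "score c \<le> (\<Sum>e\<in>H. k)"
      unfolding score_def using edges fin by (intro sum_mono) (metis card_image_le)
    then show ?thesis by simp
  qed
  then have bounded: "\<forall>d. d ` V \<subseteq> {..<k} \<longrightarrow> score d < Suc (card H * k)" by simp
  have start: "(\<lambda>_. 0) ` V \<subseteq> {..<k}" using assms(3) by auto
  obtain c where c: "c ` V \<subseteq> {..<k}"
    and best: "\<And>d. d ` V \<subseteq> {..<k} \<Longrightarrow> score d \<le> score c"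
    using ex_has_greatest_nat[where P = "\<lambda>c. c ` V \<subseteq> {..<k}" and f = score
        and k = "\<lambda>_. 0" and b = "Suc (card H * k)"] start bounded by metis
  have "inj_on c e" if e: "e \<in> H" for e
  proof (rule ccontr)
    assume "\<not> inj_on c e"
    then obtain x y where xy: "x \<in> e" "y \<in> e" "x \<noteq> y" "c x = c y" by (auto simp: inj_on_def)
    have "card (c ` e) < k"
      using edges[OF e] \<open>\<not> inj_on c e\<close> fin[OF e] by (metis card_image_le eq_card_imp_inj_on le_neq_implies_less)
    then have "c ` e \<noteq> {..<k}" by auto
    then obtain q where q: "q < k" "q \<notin> c ` e" using c edges[OF e] by blast
    define P where "P = c x"
    have P: "P < k" "P \<noteq> q" using xy c edges[OF e] q by (auto simp: P_def)
    define S where "S = {v\<in>V. c v = P \<or> c v = q}"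
    have S: "finite S" "\<And>c. set c \<subseteq> S \<Longrightarrow> \<not> odd_hole H c"
      using assms(1) no_hole by (auto simp: S_def)
    obtain f :: "'a \<Rightarrow> bool" where "\<forall>e\<in>H. \<forall>x\<in>e \<inter> S. \<forall>y\<in>e \<inter> S. x \<noteq> y \<longrightarrow>
        (\<exists>z\<in>e \<inter> S. f z) \<and> (\<exists>z\<in>e \<inter> S. \<not> f z)"
      using ex_bicolouring[OF S] by (rule exE)
    then have f: "(\<exists>z\<in>e' \<inter> S. f z) \<and> (\<exists>z\<in>e' \<inter> S. \<not> f z)"
      if "e' \<in> H" "x' \<in> e' \<inter> S" "y' \<in> e' \<inter> S" "x' \<noteq> y'" for e' x' y'
      using that by blast
    define d where "d v = (if v \<in> S then if f v then P else q else c v)" for v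
    have d: "d ` V \<subseteq> {..<k}" using c P q by (auto simp: d_def)
    have both: "{P, q} \<subseteq> d ` e'" "c ` e' \<subseteq> d ` e'"
      if e': "e' \<in> H" "x' \<in> e' \<inter> S" "y' \<in> e' \<inter> S" "x' \<noteq> y'" for e' x' y'
    proof -
      show 1: "{P, q} \<subseteq> d ` e'" using f[OF e'] by (force simp: d_def)
      show "c ` e' \<subseteq> d ` e'"
      proof
        fix a assume "a \<in> c ` e'"
        then obtain z where z: "z \<in> e'" "a = c z" by auto
        show "a \<in> d ` e'"
        proof (cases "z \<in> S")
          case True
          then show ?thesis using 1 z by (auto simp: S_def)
        next
          case False
          then show ?thesis using z by (auto simp: d_def)
        qed
      qed
    qed
    have mono: "card (c ` e') \<le> card (d ` e')" if e': "e' \<in> H" for e'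
    proof (cases "\<exists>x'\<in>e' \<inter> S. \<exists>y'\<in>e' \<inter> S. x' \<noteq> y'")
      case True
      then show ?thesis using both(2)[OF e'] fin[OF e'] by (meson card_mono finite_imageI)
    next
      case False
      show ?thesis
      proof (cases "e' \<inter> S = {}")
        case True
        then have "d ` e' = c ` e'" by (intro image_cong) (auto simp: d_def)
        then show ?thesis by simp
      next
        case nonempty: False
        then obtain s where s: "e' \<inter> S = {s}" using False by blast
        define R where "R = c ` (e' - {s})"
        have R: "finite R" "d ` (e' - {s}) = R"
          using fin[OF e'] s unfolding R_def by (auto intro!: image_cong simp: d_def)
        have "e' = insert s (e' - {s})" using s by auto
        then have img: "c ` e' = insert (c s) R" "d ` e' = insert (d s) R"
          using R(2) unfolding R_def by (metis image_insert)+
        have "d s \<notin> R"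
        proof
          assume "d s \<in> R"
          then obtain t where "d s = c t" "t \<in> e' - {s}" unfolding R_def by (rule imageE)
          then have t: "t \<in> e'" "t \<noteq> s" "c t = d s" by simp_all
          have "d s = P \<or> d s = q" using s by (auto simp: d_def)
          then have "t \<in> S" using t edges[OF e'] by (auto simp: S_def)
          then show False using t s by auto
        qed
        then show ?thesis using R(1) by (simp add: img card_insert_if)
      qed
    qed
    have xyS: "x \<in> e \<inter> S" "y \<in> e \<inter> S" using xy edges[OF e] by (auto simp: S_def P_def)
    have "q \<in> d ` e" "c ` e \<subseteq> d ` e" using both[OF e xyS xy(3)] by simp_all
    then have "c ` e \<subset> d ` e" using q(2) by (metis psubsetI)
    then have "card (c ` e) < card (d ` e)" using fin[OF e] by (simp add: psubset_card_mono)
    then have "score c < score d"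
      unfolding score_def using mono e assms(2) by (intro sum_strict_mono_ex1) auto
    then show False using best[OF d] by simp
  qed
  moreover have "c ` e = {..<k}" if "e \<in> H" "inj_on c e" for e
    using that edges[OF that(1)] c card_image[OF that(2)]
    by (intro card_subset_eq) auto
  ultimately have "\<forall>e\<in>H. bij_betw c e {..<k}" by (simp add: bij_betw_def)
  then show ?thesis using c by blast
qed

section \<open>Odd holes and induced circuits\<close>

lemma (in pre_digraph) cas_if_consecutive:
  assumes "p \<noteq> []" and "\<And>i. Suc i < length p \<Longrightarrow> head G (p ! i) = tail G (p ! Suc i)"
  shows "cas (tail G (hd p)) p (head G (last p))"
  using assms
proof (induction p)
  case (Cons a p)
  show ?case
  proof (cases "p = []")
    case False
    have "head G a = tail G (hd p)"
      using Cons.prems(2)[of 0] False by (simp add: hd_conv_nth)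
    moreover have "cas (tail G (hd p)) p (head G (last p))"
      using Cons.prems(2)[of "Suc _"] False by (intro Cons.IH) auto
    ultimately show ?thesis using False by simp
  qed simp
qed simp

text \<open>
  Induced circuits are lists of arcs; this produces one from a cyclic numbering of its vertices.
\<close>
lemma (in graph) ex_induced_circuit:
  fixes w :: "nat \<Rightarrow> 'a"
  assumes m: "3 \<le> m" and inj: "inj_on w {..<m}"
    and step: "\<And>i. i < m \<Longrightarrow> (w i, w (Suc i mod m)) \<in> arcs_ends G"
    and chordless: "\<And>i j. i < m \<Longrightarrow> j < m \<Longrightarrow> (w i, w j) \<in> arcs_ends G \<Longrightarrow>
       j = Suc i mod m \<or> i = Suc j mod m"
  shows "\<exists>p. induced_circuit G p \<and> length p = m"
proof -
  have "\<forall>i. \<exists>e. i < m \<longrightarrow> e \<in> arcs G \<and> tail G e = w i \<and> head G e = w (Suc i mod m)"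
    using step by (fastforce simp: arcs_ends_conv)
  then obtain a where a: "\<And>i. i < m \<Longrightarrow> a i \<in> arcs G \<and> tail G (a i) = w i \<and> head G (a i) = w (Suc i mod m)"
    by metis
  define p where "p = map a [0..<m]"
  have p: "length p = m" "p \<noteq> []" "set p = a ` {..<m}" using m by (auto simp: p_def)
  have hd: "tail G (hd p) = w 0" using m a[of 0] by (simp add: p_def hd_map)
  have last: "head G (last p) = w 0" using m a[of "m - 1"] by (simp add: p_def last_map)
  have "cas (w 0) p (w 0)"
    using cas_if_consecutive[of p] p m a unfolding hd last by (simp add: p_def)
  moreover have "w 0 \<in> verts G" using a[of 0] m tail_in_verts[of "a 0"] by auto
  ultimately have walk: "awalk (w 0) p (w 0)" using a p by (auto simp: awalk_def)
  have "tl (awalk_verts (w 0) p) = map (head G) p"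
    using awalk_verts_conv'[of "w 0" p "w 0"] walk p by (auto simp: awalk_def)
  moreover have "distinct (map (head G) p)"
  proof -
    have "inj_on (\<lambda>i. w (Suc i mod m)) {..<m}"
    proof (rule inj_onI)
      fix i j assume ij: "i \<in> {..<m}" "j \<in> {..<m}" "w (Suc i mod m) = w (Suc j mod m)"
      then have "Suc i mod m = Suc j mod m"
        using m by (intro inj_onD[OF inj]) auto
      then show "i = j" using ij by (auto simp: mod_Suc split: if_splits)
    qed
    moreover have "map (head G) p = map (\<lambda>i. w (Suc i mod m)) [0..<m]"
      using a by (simp add: p_def)
    ultimately show ?thesis by (simp add: distinct_map atLeast0LessThan)
  qed
  ultimately have "circuit G p" using walk p m by (auto simp: circuit_def cycle_def)
  moreover have "arcs_ends (G \<restriction> (tail G ` set p)) = arc_to_ends G ` set p \<union> (arc_to_ends G ` set p)\<inverse>"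
  proof -
    have T: "tail G ` set p = w ` {..<m}"
      using a by (auto simp: p(3) image_image intro!: image_cong)
    have I: "arc_to_ends G ` set p = (\<lambda>i. (w i, w (Suc i mod m))) ` {..<m}"
      using a by (auto simp: p(3) image_image arc_to_ends_def intro!: image_cong)
    have L: "arcs_ends (G \<restriction> (w ` {..<m})) = arcs_ends G \<inter> (w ` {..<m}) \<times> (w ` {..<m})"
      by (fastforce simp: arcs_ends_conv image_iff)
    have "(v, u) \<in> arcs_ends G" if "(u, v) \<in> arcs_ends G" for u v
      using arcs_ends_symmetric[OF sym_arcs that] .
    moreover have "Suc i mod m < m" for i using m by simp
    ultimately show ?thesis
      unfolding T I L using step chordless by (auto simp: image_iff) blast+
  qed
  ultimately show ?thesis using p by (auto simp: induced_circuit_def)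
qed

definition nbrs :: "('a, 'b) pre_digraph \<Rightarrow> 'a \<Rightarrow> 'a set" where
  "nbrs G v = {u. (v, u) \<in> arcs_ends G}"

lemma (in nomulti_digraph) card_nbrs: "card (nbrs G v) = out_degree G v"
proof -
  have "nbrs G v = head G ` out_arcs G v" by (auto simp: nbrs_def arcs_ends_conv)
  moreover have "inj_on (head G) (out_arcs G v)"
    using no_multi_arcs by (auto simp: inj_on_def arc_to_ends_def)
  ultimately show ?thesis by (simp add: out_degree_def card_image)
qed

text \<open>
  The circuit alternates between the vertices of the hole and vertices of \<open>B\<close> whose neighbourhoods
  are the edges of the hole. It has no chord, because these neighbourhoods contain no vertex of the
  hole apart from the two consecutive ones.
\<close>
lemma (in graph) induced_circuit_if_odd_hole:
  assumes disj: "A \<inter> B = {}" and c: "set c \<subseteq> A" and hole: "odd_hole (nbrs G ` B) c"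
    and cross: "\<And>u v. (u, v) \<in> arcs_ends G \<Longrightarrow> u \<in> A \<and> v \<in> B \<or> u \<in> B \<and> v \<in> A"
  shows "\<exists>p. induced_circuit G p \<and> length p = 2 * length c"
proof -
  define n where "n = length c"
  have n: "3 \<le> n" and dist: "distinct c" using hole by (auto simp: odd_hole_def n_def)
  have "\<forall>i. \<exists>b. i < n \<longrightarrow> b \<in> B \<and> nbrs G b \<inter> set c = {c ! i, c ! (Suc i mod n)}"
    using hole by (fastforce simp: odd_hole_def n_def)
  then obtain b where b: "\<And>i. i < n \<Longrightarrow> b i \<in> B"
    and nb: "\<And>i. i < n \<Longrightarrow> nbrs G (b i) \<inter> set c = {c ! i, c ! (Suc i mod n)}"
    by metis
  have modn: "Suc i mod n < n" for i using n by simp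
  have ceq: "c ! i = c ! j \<longleftrightarrow> i = j" if "i < n" "j < n" for i j
    using that dist by (simp add: n_def nth_eq_iff_index_eq)
  have cA: "c ! i \<in> A" if "i < n" for i using that c by (auto simp: n_def)
  have adj: "(b j, c ! i) \<in> arcs_ends G \<longleftrightarrow> i = j \<or> i = Suc j mod n" if "i < n" "j < n" for i j
  proof -
    have "(b j, c ! i) \<in> arcs_ends G \<longleftrightarrow> c ! i \<in> nbrs G (b j) \<inter> set c"
      using that by (simp add: nbrs_def n_def)
    then show ?thesis using nb[OF that(2)] ceq that modn by auto
  qed
  have sym: "(u, v) \<in> arcs_ends G \<longleftrightarrow> (v, u) \<in> arcs_ends G" for u v
    using arcs_ends_symmetric[OF sym_arcs] by blast
  \<comment> \<open>Two edges with the same trace would make the hole go back and forth, against \<open>3 \<le> n\<close>.\<close>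
  have b_inj: "i = j" if "i < n" "j < n" "b i = b j" for i j
  proof (rule ccontr)
    assume "i \<noteq> j"
    have "i = j \<or> i = Suc j mod n" "j = i \<or> j = Suc i mod n"
      using adj[of i i] adj[of i j] adj[of j j] adj[of j i] that by auto
    then show False using \<open>i \<noteq> j\<close> n that by (auto simp: mod_Suc split: if_splits)
  qed
  define w where "w i = (if even i then c ! (i div 2) else b (i div 2))" for i
  have w_even: "w (2 * i) = c ! i" and w_odd: "w (Suc (2 * i)) = b i" for i
    by (auto simp: w_def)
  have wA: "w i \<in> A \<longleftrightarrow> even i" if "i < 2 * n" for i
  proof -
    have "i div 2 < n" using that by auto
    then show ?thesis using cA b disj by (auto simp: w_def)
  qed
  have succ_odd: "Suc (Suc (2 * i)) mod (2 * n) = 2 * (Suc i mod n)" for i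
    by (metis mult_Suc_right add_2_eq_Suc mult_mod_right)
  have "\<exists>p. induced_circuit G p \<and> length p = 2 * n"
  proof (rule ex_induced_circuit[of "2 * n" w])
    show "3 \<le> 2 * n" using n by simp
    show "inj_on w {..<2 * n}"
    proof (rule inj_onI)
      fix i j assume ij: "i \<in> {..<2 * n}" "j \<in> {..<2 * n}" "w i = w j"
      then have par: "even i = even j" using wA by (metis lessThan_iff)
      have "i div 2 < n" "j div 2 < n" using ij by auto
      then have "i div 2 = j div 2"
        using ij(3) par ceq b_inj by (auto simp: w_def split: if_splits)
      then show "i = j" using par by (metis even_two_times_div_two odd_two_times_div_two_succ)
    qed
    show "(w i, w (Suc i mod (2 * n))) \<in> arcs_ends G" if "i < 2 * n" for i
    proof (cases "even i")
      case True
      then obtain l where l: "i = 2 * l" by blast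
      then have "Suc i mod (2 * n) = Suc (2 * l)" using that by (simp add: mod_less)
      then show ?thesis using adj[of l l] that l sym w_even w_odd by auto
    next
      case False
      then obtain l where l: "i = Suc (2 * l)" by (metis oddE Suc_eq_plus1)
      then show ?thesis using adj[of "Suc l mod n" l] that modn
        by (simp only: l succ_odd w_even w_odd) simp
    qed
    have key: "i = Suc j mod (2 * n) \<or> j = Suc i mod (2 * n)"
      if ij: "i < 2 * n" "j < 2 * n" "even i" "odd j" "(w j, w i) \<in> arcs_ends G" for i j
    proof -
      obtain l where l: "i = 2 * l" using \<open>even i\<close> by blast
      obtain r where r: "j = Suc (2 * r)" using \<open>odd j\<close> by (metis oddE Suc_eq_plus1)
      have "l = r \<or> l = Suc r mod n" using ij adj[of l r] by (simp add: l r w_even w_odd)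
      then show ?thesis
      proof
        assume "l = r"
        then show ?thesis using ij l r by simp
      next
        assume "l = Suc r mod n"
        then show ?thesis using succ_odd[of r] l r by simp
      qed
    qed
    show "j = Suc i mod (2 * n) \<or> i = Suc j mod (2 * n)"
      if ij: "i < 2 * n" "j < 2 * n" "(w i, w j) \<in> arcs_ends G" for i j
    proof -
      have "even i \<noteq> even j" using cross[OF ij(3)] wA ij disj by blast
      then show ?thesis using key[of i j] key[of j i] ij sym by blast
    qed
  qed
  then show ?thesis by (simp add: n_def)
qed

section \<open>Counting with the colour classes\<close>

theorem theorem1p3:
  fixes G :: "('a, 'b) pre_digraph" and k :: nat
  assumes "k \<ge> 1"
    and "graph G"
    and "Digraph_Component.connected G"
    and "k_regular k G"
    and "balanced G"
  shows "2 * k dvd card (verts G)"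
proof -
  interpret graph G by fact
  obtain A B where AB: "A \<union> B = verts G" "A \<inter> B = {}"
    and ends: "\<forall>e\<in>arcs G. tail G e \<in> A \<and> head G e \<in> B \<or> tail G e \<in> B \<and> head G e \<in> A"
    using assms(5) by (auto simp: balanced_def bipartite_def)
  have cross: "u \<in> A \<and> v \<in> B \<or> u \<in> B \<and> v \<in> A" if "(u, v) \<in> arcs_ends G" for u v
    using that ends by (auto simp: arcs_ends_conv)
  have sym: "u \<in> nbrs G v \<longleftrightarrow> v \<in> nbrs G u" for u v
    using arcs_ends_symmetric[OF sym_arcs] by (auto simp: nbrs_def)
  have fin: "finite A" "finite B" using AB(1) finite_verts by (metis finite_Un)+
  have NA: "nbrs G a \<subseteq> B" if "a \<in> A" for a
    using that cross AB(2) by (auto simp: nbrs_def)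
  have NB: "nbrs G b \<subseteq> A" if "b \<in> B" for b
    using that cross AB(2) by (auto simp: nbrs_def)
  have card_N: "card (nbrs G v) = k" if "v \<in> A \<union> B" for v
    using that assms(4) AB(1) by (simp add: card_nbrs k_regular_def)
  have no_hole: "\<not> odd_hole (nbrs G ` B) c" if "set c \<subseteq> A" for c
  proof
    assume hole: "odd_hole (nbrs G ` B) c"
    then obtain p where "induced_circuit G p" "length p = 2 * length c"
      using induced_circuit_if_odd_hole[of A B c] AB(2) \<open>set c \<subseteq> A\<close> cross by blast
    moreover have "2 * length c mod 4 = 2"
    proof -
      have "odd (length c)" using hole by (simp add: odd_hole_def)
      then show ?thesis by presburger
    qed
    ultimately show False using assms(5) by (auto simp: balanced_def)
  qed
  have edges: "e \<subseteq> A \<and> card e = k" if "e \<in> nbrs G ` B" for e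
    using that NB card_N by auto
  obtain col where col_all: "col ` A \<subseteq> {..<k} \<and> (\<forall>e\<in>nbrs G ` B. bij_betw col e {..<k})"
    using ex_rainbow_colouring[OF fin(1) finite_imageI[OF fin(2)] assms(1) edges no_hole] by (rule exE)
  then have col: "col ` A \<subseteq> {..<k}" by (rule conjunct1)
  have rainbow: "bij_betw col (nbrs G b) {..<k}" if "b \<in> B" for b using col_all that by simp
  \<comment> \<open>The neighbourhoods of the vertices of one colour class partition \<open>B\<close>.\<close>
  define C where "C i = {a \<in> A. col a = i}" for i
  have card_B: "card B = k * card (C i)" if "i < k" for i
  proof -
    have "B = (\<Union>a\<in>C i. nbrs G a)"
    proof
      show "B \<subseteq> (\<Union>a\<in>C i. nbrs G a)"
      proof
        fix b assume b: "b \<in> B"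
        then have "i \<in> col ` nbrs G b" using rainbow that by (simp add: bij_betw_def)
        then show "b \<in> (\<Union>a\<in>C i. nbrs G a)" using NB[OF b] sym by (auto simp: C_def)
      qed
    qed (use NA in \<open>auto simp: C_def\<close>)
    also have "card \<dots> = (\<Sum>a\<in>C i. card (nbrs G a))"
    proof (rule card_UN_disjoint)
      show "\<forall>a\<in>C i. \<forall>a'\<in>C i. a \<noteq> a' \<longrightarrow> nbrs G a \<inter> nbrs G a' = {}"
      proof (intro ballI impI, rule ccontr)
        fix a a' assume a: "a \<in> C i" "a' \<in> C i" "a \<noteq> a'" "nbrs G a \<inter> nbrs G a' \<noteq> {}"
        then obtain b where "b \<in> B" "a \<in> nbrs G b" "a' \<in> nbrs G b"
          using NA sym by (fastforce simp: C_def)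
        then show False using rainbow a by (auto simp: bij_betw_def inj_on_def C_def)
      qed
    qed (use fin in \<open>auto simp: C_def intro: finite_subset[OF NA fin(2)]\<close>)
    also have "\<dots> = k * card (C i)" using card_N by (simp add: C_def)
    finally show ?thesis .
  qed
  have "card A = (\<Sum>i<k. card (C i))"
    using sum.group[OF fin(1) finite_lessThan col, of "\<lambda>_. 1 :: nat"] by (simp add: C_def)
  also have "\<dots> = (\<Sum>i<k. card (C 0))"
  proof (rule sum.cong)
    show "card (C i) = card (C 0)" if "i \<in> {..<k}" for i
      using card_B[of i] card_B[of 0] assms(1) that by simp
  qed simp
  finally have "card A = k * card (C 0)" by simp
  moreover have "card B = k * card (C 0)" using card_B[of 0] assms(1) by simp
  moreover have "card (verts G) = card A + card B"
    using card_Un_disjoint[OF fin AB(2)] AB(1) by simp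
  ultimately have "card (verts G) = 2 * k * card (C 0)" by simp
  then show ?thesis by (rule dvdI)
qed

end
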